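(* The set of partitions of positive rational numbers is obtained by multiplying partitions $n=n_1+n_2+\cdots+n_l$ of positive integers by $\dfrac{1}{\operatorname{lcm}(n_1,n_2,\dots,n_l,r)}$. That is: for every positive integer $n$ and every $l\in\{1,\dots,n\}$ there exist positive integers $n_1,\dots,n_l$ (with $n=n_1+\cdots+n_l$) such that for every positive integer $r$ $$\frac{n}{\operatorname{lcm}(n_1,\dots,n_l,r)}=\frac{1}{\frac{\operatorname{lcm}(n_1,\dots,n_l,r)}{n_1}}+\frac{1}{\frac{\operatorname{lcm}(n_1,\dots,n_l,r)}{n_2}}+\cdots+\frac{1}{\frac{\operatorname{lcm}(n_1,\dots,n_l,r)}{n_l}},$$ and the set of partitions of positive rational numbers is obtained in this way.
   Context: A partition of a positive integer $n$ is a finite collection of positive integers (called sizes) whose sum is $n$. A partition of a positive rational number is a finite collection of positive rational numbers whose sum is that number; the partitions of rational numbers considered here are the representations $\frac ab=\frac1{x_1}+\cdots+\frac1{x_r}$ of a positive rational number as a sum of unit fractions with positive integers $x_i$. *)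

theory Defs
  imports Complex_Main "HOL-Library.Multiset"
begin

text \<open>
  Partitions are unordered collections with repetition, hence multisets. One definition serves
  positive integers (type \<^typ>\<open>nat\<close>) and positive rationals (type \<^typ>\<open>rat\<close>);
  the requirement that the total be positive excludes the empty partition.
\<close>

definition partition_of :: "'a::ordered_comm_monoid_add \<Rightarrow> 'a multiset \<Rightarrow> bool" where
  "partition_of s P \<longleftrightarrow> 0 < s \<and> (\<forall>x\<in>#P. 0 < x) \<and> sum_mset P = s"

definition unit_fraction :: "rat \<Rightarrow> bool" where
  "unit_fraction x \<longleftrightarrow> (\<exists>k::nat. 0 < k \<and> x = 1 / of_nat k)"

text \<open>
  The representations \<open>a/b = 1/x\<^sub>1 + \<dots> + 1/x\<^sub>r\<close>, each recorded as the number represented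
  together with the multiset of its summands.
\<close>

definition rational_partitions :: "(rat \<times> rat multiset) set" where
  "rational_partitions = {(q, X). partition_of q X \<and> (\<forall>x\<in>#X. unit_fraction x)}"

definition lcm_with :: "nat multiset \<Rightarrow> nat \<Rightarrow> nat" where
  "lcm_with N r = Lcm (insert r (set_mset N))"

text \<open>The equation \<open>n = n\<^sub>1 + \<dots> + n\<^sub>l\<close> multiplied by \<open>1 / lcm(n\<^sub>1, \<dots>, n\<^sub>l, r)\<close>.\<close>

definition scaled_partition :: "nat \<Rightarrow> nat multiset \<Rightarrow> nat \<Rightarrow> rat \<times> rat multiset" where
  "scaled_partition n N r =
     (1 / of_nat (lcm_with N r) * of_nat n,
      image_mset (\<lambda>m. 1 / of_nat (lcm_with N r) * of_nat m) N)"

end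

theory Submission
  imports Defs
begin

text \<open>
  Let \<open>L\<close> be the least common multiple of the parts of a partition of \<open>n\<close> and a positive number
  \<open>r\<close>. Each part \<open>m\<close> divides \<open>L\<close>, so \<open>m / L = 1 / (L / m)\<close> is a unit fraction, and dividing
  \<open>n = n\<^sub>1 + \<dots> + n\<^sub>l\<close> by \<open>L\<close> represents \<open>n / L\<close> as a sum of unit fractions
  (\<open>scaled_partition_in_rational_partitions\<close>). Every length \<open>l\<close> from \<open>1\<close> to \<open>n\<close> occurs, as
  \<open>n = (n - l + 1) + 1 + \<dots> + 1\<close> shows.

  Conversely (\<open>rational_partition_is_scaled\<close>), clear denominators in
  \<open>q = 1 / x\<^sub>1 + \<dots> + 1 / x\<^sub>l\<close> with \<open>L = lcm(x\<^sub>1, \<dots>, x\<^sub>l)\<close>: the integers \<open>n\<^sub>i = L / x\<^sub>i\<close> partition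
  \<open>n = L q\<close>. The least common multiple of the \<open>n\<^sub>i\<close> alone may be a proper divisor of \<open>L\<close> (for
  \<open>1/2\<close> as a single term, the only part is \<open>1\<close>, whereas \<open>L = 2\<close>), and the parameter \<open>r\<close> repairs exactly this:
  since every \<open>n\<^sub>i\<close> divides \<open>L\<close>, the choice \<open>r = L\<close> gives \<open>lcm(n\<^sub>1, \<dots>, n\<^sub>l, r) = L\<close>.
\<close>

lemma lcm_with_pos:
  assumes "partition_of n N" and "0 < r"
  shows "0 < lcm_with N r"
  using assms by (auto simp: lcm_with_def partition_of_def Lcm_0_iff intro!: Nat.gr0I)

lemma part_dvd_lcm_with: "m \<in># N \<Longrightarrow> m dvd lcm_with N r"
  by (simp add: lcm_with_def)

lemma lcm_with_eq_if_parts_dvd: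
  assumes "\<And>m. m \<in># N \<Longrightarrow> m dvd r"
  shows "lcm_with N r = r"
  unfolding lcm_with_def using assms by (intro dvd_antisym Lcm_least) auto

lemma of_nat_sum_mset: "of_nat (\<Sum>\<^sub># N) = (\<Sum>m\<in>#N. of_nat m :: 'a::semiring_1)"
  by (induction N) auto

lemma sum_scaled_parts:
  assumes "partition_of n N"
  shows "(\<Sum>m\<in>#N. c * of_nat m) = c * (of_nat n :: 'a::semiring_1)"
  using assms by (auto simp: partition_of_def of_nat_sum_mset simp flip: sum_mset_distrib_left)

lemma scaled_partition_in_rational_partitions:
  assumes N: "partition_of n N" and r: "0 < r"
  shows "scaled_partition n N r \<in> rational_partitions"
proof -
  define L where "L = lcm_with N r"
  have L: "0 < L"
    using lcm_with_pos[OF N r] by (simp add: L_def)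
  have unit: "unit_fraction (1 / of_nat L * of_nat m)" if m: "m \<in># N" for m
  proof -
    obtain k where k: "L = m * k"
      using part_dvd_lcm_with[OF m] by (auto simp: L_def elim: dvdE)
    with L have "0 < k" and "1 / of_nat L * of_nat m = (1 / of_nat k :: rat)"
      by auto
    then show ?thesis
      by (auto simp: unit_fraction_def)
  qed
  have "partition_of (1 / of_nat L * of_nat n :: rat)
          (image_mset (\<lambda>m. 1 / of_nat L * of_nat m) N)"
    using N L sum_scaled_parts[OF N, of "1 / of_nat L :: rat"]
    by (auto simp: partition_of_def)
  with unit show ?thesis
    by (auto simp: rational_partitions_def scaled_partition_def L_def)
qed

text \<open>
  Clearing denominators inverts the scaling: a summand \<open>x = 1 / k\<close> comes from the part \<open>L / k\<close>,
  and \<open>r\<close> is the common denominator \<open>L\<close> itself, so that the scaling factor is \<open>1 / L\<close> even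
  if the parts have a smaller least common multiple.
\<close>

lemma rational_partition_is_scaled:
  assumes "(q, X) \<in> rational_partitions"
  obtains n N r where "partition_of n N" and "0 < r" and "(q, X) = scaled_partition n N r"
proof -
  have q: "0 < q" "\<Sum>\<^sub># X = q" and "\<forall>x\<in>#X. \<exists>k::nat. 0 < k \<and> x = 1 / of_nat k"
    using assms by (auto simp: rational_partitions_def partition_of_def unit_fraction_def)
  then obtain den :: "rat \<Rightarrow> nat"
    where den: "\<And>x. x \<in># X \<Longrightarrow> 0 < den x \<and> x = 1 / of_nat (den x)"
    by metis
  define L where "L = Lcm (den ` set_mset X)"
  define N where "N = image_mset (\<lambda>x. L div den x) X"
  have "0 \<notin> den ` set_mset X"
    using den by force
  then have L: "0 < L"
    by (auto simp: L_def Lcm_0_iff intro!: Nat.gr0I)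
  have dvd: "den x dvd L" if "x \<in># X" for x
    using that by (simp add: L_def)
  have part: "of_nat (L div den x) = of_nat L * x" if "x \<in># X" for x
  proof -
    have "(of_nat (L div den x) :: rat) = of_nat L / of_nat (den x)"
      using dvd[OF that] den[OF that] by (auto elim!: dvdE)
    also have "\<dots> = of_nat L * (1 / of_nat (den x))"
      by simp
    finally show ?thesis
      using den[OF that] by simp
  qed
  have lcm: "lcm_with N L = L"
  proof (rule lcm_with_eq_if_parts_dvd)
    fix m
    assume "m \<in># N"
    then obtain x where x: "x \<in># X" "m = L div den x"
      by (auto simp: N_def)
    then have "L = m * den x"
      using dvd by simp
    then show "m dvd L"
      by (rule dvdI)
  qed
  have sum: "of_nat (\<Sum>\<^sub># N) = of_nat L * q"
  proof -
    have "(of_nat (\<Sum>\<^sub># N) :: rat) = (\<Sum>x\<in>#X. of_nat (L div den x))"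
      by (simp add: N_def of_nat_sum_mset image_mset.compositionality comp_def)
    also have "\<dots> = (\<Sum>x\<in>#X. of_nat L * x)"
      using part by (metis (mono_tags, lifting) image_mset_cong)
    finally show ?thesis
      using q by (simp flip: sum_mset_distrib_left)
  qed
  have "partition_of (\<Sum>\<^sub># N) N"
  proof -
    have "0 < (of_nat (\<Sum>\<^sub># N) :: rat)"
      using sum L q by simp
    then have "0 < \<Sum>\<^sub># N"
      by (simp only: of_nat_0_less_iff)
    moreover have "0 < L div den x" if "x \<in># X" for x
      using that dvd den L by (simp add: dvd_imp_le div_greater_zero_iff)
    ultimately show ?thesis
      unfolding partition_of_def by (auto simp: N_def)
  qed
  moreover have "(q, X) = scaled_partition (\<Sum>\<^sub># N) N L"
  proof -
    have "image_mset (\<lambda>m. 1 / of_nat L * of_nat m) N = image_mset (\<lambda>x. x) X"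
      unfolding N_def image_mset.compositionality comp_def
      by (rule image_mset_cong) (use part L in simp)
    then show ?thesis
      using sum L by (simp add: scaled_partition_def lcm)
  qed
  ultimately show thesis
    using L that by blast
qed

lemma ex_partition_of_size:
  assumes "l \<in> {1..n}"
  obtains N :: "nat multiset" where "size N = l" and "partition_of n N"
proof
  let ?N = "add_mset (n - l + 1) (replicate_mset (l - 1) 1)"
  show "size ?N = l" and "partition_of n ?N"
    using assms by (auto simp: partition_of_def)
qed

theorem theorem3p1:
  "(\<forall>(n::nat) (l::nat). 0 < n \<longrightarrow> l \<in> {1..n} \<longrightarrow>
      (\<exists>N::nat multiset. size N = l \<and> partition_of n N \<and>
        (\<forall>r::nat. 0 < r \<longrightarrow>
          (of_nat n :: rat) / of_nat (lcm_with N r) =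
            (\<Sum>m\<in>#N. 1 / (of_nat (lcm_with N r) / of_nat m)))))
   \<and> rational_partitions =
      {scaled_partition n N r | (n::nat) (N::nat multiset) (r::nat). partition_of n N \<and> 0 < r}"
proof (intro conjI allI impI)
  fix n l :: nat
  assume "l \<in> {1..n}"
  then obtain N where size: "size N = l" and N: "partition_of n N"
    by (rule ex_partition_of_size)
  have "(of_nat n :: rat) / of_nat L = (\<Sum>m\<in>#N. 1 / (of_nat L / of_nat m))" for L :: nat
    using sum_scaled_parts[OF N, of "1 / of_nat L :: rat"] by simp
  with size N
  show "\<exists>N. size N = l \<and> partition_of n N \<and>
      (\<forall>r. 0 < r \<longrightarrow> (of_nat n :: rat) / of_nat (lcm_with N r) =
         (\<Sum>m\<in>#N. 1 / (of_nat (lcm_with N r) / of_nat m)))"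
    by blast
next
  show "rational_partitions = {scaled_partition n N r | n N r. partition_of n N \<and> 0 < r}"
    using scaled_partition_in_rational_partitions
    by (auto elim!: rational_partition_is_scaled)
qed

end
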